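(* Let $0<\alpha<1$ and $t_k=e^{(k-1)^\alpha}$ for $k\ge1$. Suppose that Assumption $A_1$ (local error bound condition) holds, let $(x_k)$ be generated by the Inertial Forward-Backward algorithm with this $(t_k)$, and let $x_*\in X$. Then, as $k\to\infty$: 1) $F(x_k)-F(x_* )=o\left(\frac{1}{e^{2(k-1)^\alpha}}\right)$ and $\|x_k-x_{k-1}\|=O\left(\frac{1}{e^{(k-1)^\alpha}}\right)$. 2) $(x_k)$ converges (in norm) to some $\bar x\in X$, with rate $\|x_k-\bar x\|=O\left((k-1)^{\alpha\lceil\frac1\alpha-1\rceil}e^{-(k-1)^\alpha}\right)$.
   Context: Setting. $H$ is a real Hilbert space; $f:H\to\mathbb{R}$ is convex and continuously differentiable with $L_f$-Lipschitz continuous gradient ($L_f>0$); $g:H\to\mathbb{R}\cup\{+\infty\}$ is proper, lower semicontinuous and convex; $F:=f+g$. It is assumed that $X:=\arg\min F\neq\emptyset$, and $F_*:=\min F=F(x_* )$ for $x_*\in X$. For $\lambda>0$, $\mathrm{prox}_{\lambda g}(z):=\arg\min_{x\in H}\{g(x)+\frac{1}{2\lambda}\|x-z\|^2\}$ and $T_\lambda(x):=\mathrm{prox}_{\lambda g}(x-\lambda\nabla f(x))$. Inertial Forward-Backward algorithm (IFB). Fix $\mu\in(0,1)$, $\lambda=\mu/L_f$, a starting point $x_0\in H$, $y_1=x_0$, and the sequence $(t_k)_{k\ge1}$ (with $t_1=1$). For $k\ge1$: $x_k=T_\lambda(y_k)$ and $y_{k+1}=x_k+\gamma_k(x_k-x_{k-1})$,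 where $\gamma_k=\frac{t_k-1}{t_{k+1}}$. Assumption $A_1$ (local error bound condition): for any $\xi\ge F_*$ there exist $\varepsilon>0$ and $\bar\tau>0$ such that $\mathrm{dist}(x,X)\le\bar\tau\,\|T_{1/L_f}(x)-x\|$ whenever $\|T_{1/L_f}(x)-x\|<\varepsilon$ and $F(x)\le\xi$. *)

theory Defs
  imports "HOL-Analysis.Analysis" "HOL-Library.Landau_Symbols"
begin

text \<open>
  Functions with values in the reals extended by plus infinity are modelled as
  \<^typ>\<open>ereal\<close>-valued functions that never take the value minus infinity; the latter
  condition is part of \<open>proper_fun\<close>.
\<close>

definition proper_fun :: "('a \<Rightarrow> ereal) \<Rightarrow> bool" where
  "proper_fun g \<longleftrightarrow> (\<forall>x. g x \<noteq> -\<infinity>) \<and> (\<exists>x. g x \<noteq> \<infinity>)"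

definition lower_semicontinuous :: "('a::topological_space \<Rightarrow> ereal) \<Rightarrow> bool" where
  "lower_semicontinuous g \<longleftrightarrow> (\<forall>x. g x \<le> Liminf (at x) g)"

definition convex_ereal_fun :: "('a::real_vector \<Rightarrow> ereal) \<Rightarrow> bool" where
  "convex_ereal_fun g \<longleftrightarrow>
     (\<forall>x y. \<forall>u::real. 0 \<le> u \<longrightarrow> u \<le> 1 \<longrightarrow>
        g ((1 - u) *\<^sub>R x + u *\<^sub>R y) \<le> ereal (1 - u) * g x + ereal u * g y)"

definition composite :: "('a \<Rightarrow> real) \<Rightarrow> ('a \<Rightarrow> ereal) \<Rightarrow> 'a \<Rightarrow> ereal" where
  "composite f g x = ereal (f x) + g x"

definition argmin_set :: "('a \<Rightarrow> ereal) \<Rightarrow> 'a set" where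
  "argmin_set h = {x. \<forall>y. h x \<le> h y}"

text \<open>
  \<^const>\<open>arg_min\<close> selects some minimiser. For a proper, lower semicontinuous and convex \<open>g\<close> on
  a Hilbert space and \<open>l > 0\<close> the minimiser exists and is unique.
\<close>

definition prox :: "real \<Rightarrow> ('a::real_inner \<Rightarrow> ereal) \<Rightarrow> 'a \<Rightarrow> 'a" where
  "prox l g z = arg_min (\<lambda>x. g x + ereal (1 / (2 * l) * (norm (x - z))\<^sup>2)) (\<lambda>_. True)"

text \<open>In the following, \<open>gf\<close> stands for the gradient of the smooth part.\<close>

definition forward_backward ::
  "('a::real_inner \<Rightarrow> 'a) \<Rightarrow> ('a \<Rightarrow> ereal) \<Rightarrow> real \<Rightarrow> 'a \<Rightarrow> 'a" where
  "forward_backward gf g l x = prox l g (x - l *\<^sub>R gf x)"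

text \<open>The infimum below is the minimal value whenever the minimum is attained.\<close>

definition local_error_bound ::
  "('a::real_inner \<Rightarrow> real) \<Rightarrow> ('a \<Rightarrow> 'a) \<Rightarrow> ('a \<Rightarrow> ereal) \<Rightarrow> real \<Rightarrow> bool" where
  "local_error_bound f gf g L \<longleftrightarrow>
     (\<forall>\<xi>::real. (INF z. composite f g z) \<le> ereal \<xi> \<longrightarrow>
        (\<exists>\<epsilon>>0. \<exists>\<tau>>0. \<forall>x.
           norm (forward_backward gf g (1 / L) x - x) < \<epsilon> \<and> composite f g x \<le> ereal \<xi> \<longrightarrow>
           infdist x (argmin_set (composite f g))
             \<le> \<tau> * norm (forward_backward gf g (1 / L) x - x)))"

text \<open>The values \<open>t 0\<close> and \<open>y 0\<close> play no role.\<close>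

definition inertial_forward_backward ::
  "('a::real_inner \<Rightarrow> 'a) \<Rightarrow> ('a \<Rightarrow> ereal) \<Rightarrow> real \<Rightarrow> (nat \<Rightarrow> real) \<Rightarrow> 'a
     \<Rightarrow> (nat \<Rightarrow> 'a) \<Rightarrow> (nat \<Rightarrow> 'a) \<Rightarrow> bool" where
  "inertial_forward_backward gf g l t x0 x y \<longleftrightarrow>
     x 0 = x0 \<and> y 1 = x0 \<and>
     (\<forall>k\<ge>1. x k = forward_backward gf g l (y k) \<and>
            y (k + 1) = x k + ((t k - 1) / t (k + 1)) *\<^sub>R (x k - x (k - 1)))"

end

theory Submission
  imports Defs "HOL-Real_Asymp.Real_Asymp"
begin

text \<open>
  Write \<open>v\<^sub>k = F(x\<^sub>k) - F\<^sub>*\<close> and \<open>\<delta>\<^sub>k = \<parallel>x\<^sub>k - x\<^sub>k\<^sub>-\<^sub>1\<parallel>\<^sup>2 / (2\<lambda>)\<close>. Comparing the forward-backward step from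
  \<open>y\<^sub>k\<^sub>+\<^sub>1\<close> with \<open>x\<^sub>k\<close> gives
  \<open>v\<^sub>k\<^sub>+\<^sub>1 + \<delta>\<^sub>k\<^sub>+\<^sub>1 + c \<parallel>x\<^sub>k\<^sub>+\<^sub>1 - y\<^sub>k\<^sub>+\<^sub>1\<parallel>\<^sup>2 \<le> v\<^sub>k + \<gamma>\<^sub>k\<^sup>2 \<delta>\<^sub>k\<close>, with \<open>c > 0\<close> because \<open>\<mu> < 1\<close>. Hence the residuals
  \<open>\<parallel>x\<^sub>k - y\<^sub>k\<parallel>\<close> tend to 0, the error bound eventually applies, and comparison with the solution set gives
  \<open>v\<^sub>k\<^sub>+\<^sub>1 \<le> C \<parallel>x\<^sub>k\<^sub>+\<^sub>1 - y\<^sub>k\<^sub>+\<^sub>1\<parallel>\<^sup>2\<close>. So \<open>(1 + \<sigma>) v\<^sub>k\<^sub>+\<^sub>1 + \<delta>\<^sub>k\<^sub>+\<^sub>1 \<le> v\<^sub>k + \<gamma>\<^sub>k\<^sup>2 \<delta>\<^sub>k\<close> for some \<open>\<sigma> > 0\<close>. As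
  \<open>t\<^sub>k\<^sub>+\<^sub>1 / t\<^sub>k\<close> tends to 1, the energy \<open>(1 + \<sigma>) t\<^sub>k\<^sup>2 v\<^sub>k + t\<^sub>k\<^sup>2 \<delta>\<^sub>k\<close> eventually decreases by at least
  \<open>(\<sigma>/2) t\<^sub>k\<^sup>2 v\<^sub>k\<close> per step, which yields both rates of part 1. The steps are then summable, and summing
  their tail gives the rate of the iterates, even with the exponent \<open>1 - \<alpha>\<close> in place of
  \<open>\<alpha> \<lceil>1/\<alpha> - 1\<rceil>\<close>.
\<close>

section \<open>Subgradients at minimisers and the descent lemma\<close>

lemma GDERIV_line:
  assumes "GDERIV h (p + s *\<^sub>R v) :> d"
  shows "((\<lambda>s. h (p + s *\<^sub>R v)) has_real_derivative d \<bullet> v) (at s)"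
proof -
  have h: "(h has_derivative (\<lambda>w. w \<bullet> d)) (at (p + s *\<^sub>R v))"
    using assms by (simp add: gderiv_def)
  have "((\<lambda>s. p + s *\<^sub>R v) has_derivative (\<lambda>r. r *\<^sub>R v)) (at s)"
    by (auto intro!: derivative_eq_intros)
  from has_derivative_compose[OF this h] show ?thesis
    by (simp add: has_field_derivative_def mult_commute_abs inner_commute)
qed

text \<open>Convexity of \<open>g\<close> on the segment from \<open>p\<close> to \<open>w\<close>,
  combined with minimality, bounds the difference quotients of \<open>h\<close> below by
  \<open>c - g w\<close>; letting the step tend to 0 from the right gives the claim. Thus
  \<open>- d\<close> is a subgradient of \<open>g\<close> at \<open>p\<close>, with no convexity
  asked of \<open>h\<close>.\<close>

lemma convex_ereal_minimum_subgradient: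
  assumes g: "convex_ereal_fun g" "\<And>w. g w \<noteq> -\<infinity>" "g p = ereal c"
    and h: "GDERIV h p :> d"
    and min: "\<And>w. ereal (h p) + g p \<le> ereal (h w) + g w"
  shows "ereal (c - d \<bullet> (w - p)) \<le> g w"
proof (cases "g w")
  case (real r)
  have ineq: "(h (p + u *\<^sub>R (w - p)) - h p) / u \<ge> c - r" if u: "0 < u" "u < 1" for u
  proof -
    have eq: "p + u *\<^sub>R (w - p) = (1 - u) *\<^sub>R p + u *\<^sub>R w" by (simp add: algebra_simps)
    have le: "g (p + u *\<^sub>R (w - p)) \<le> ereal ((1 - u) * c + u * r)"
      using g(1)[unfolded convex_ereal_fun_def, rule_format, of u p w] u real g(3)
      by (simp add: eq)
    have "ereal (h p + c) \<le> ereal (h (p + u *\<^sub>R (w - p))) + ereal ((1 - u) * c + u * r)"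
      using order_trans[OF min[of "p + u *\<^sub>R (w - p)"] add_left_mono[OF le]] g(3) by simp
    then have "u * (c - r) \<le> h (p + u *\<^sub>R (w - p)) - h p" by (simp add: algebra_simps)
    then show ?thesis using u by (simp add: pos_le_divide_eq mult.commute)
  qed
  have "((\<lambda>s. h (p + s *\<^sub>R (w - p))) has_real_derivative d \<bullet> (w - p)) (at 0)"
    by (rule GDERIV_line) (simp add: h)
  then have "((\<lambda>u. (h (p + u *\<^sub>R (w - p)) - h p) / u) \<longlongrightarrow> d \<bullet> (w - p)) (at_right 0)"
    unfolding DERIV_def by (auto intro: tendsto_within_subset)
  moreover have "eventually (\<lambda>u. (h (p + u *\<^sub>R (w - p)) - h p) / u \<ge> c - r) (at_right 0)"
    using ineq eventually_at_right_less[of "0::real"] eventually_at_right[of 0 "1::real"]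
    by (metis (mono_tags, lifting) zero_less_one)
  ultimately have "d \<bullet> (w - p) \<ge> c - r"
    by (intro tendsto_lowerbound[where F="at_right 0"]) auto
  then show ?thesis using real by simp
qed (use g in auto)

lemma convex_gradient_inequality:
  fixes f :: "'a::real_inner \<Rightarrow> real"
  assumes "convex_on UNIV f" "GDERIV f p :> d"
  shows "f p + d \<bullet> (w - p) \<le> f w"
proof -
  have "convex_ereal_fun (\<lambda>x. ereal (f x))"
    using assms(1) by (auto simp: convex_ereal_fun_def convex_on_def intro: convex_onD)
  \<comment> \<open>every point minimises \<open>- f + f\<close>\<close>
  from convex_ereal_minimum_subgradient[OF this, of p "f p" "\<lambda>x. - f x" "- d" w]
  show ?thesis using GDERIV_minus[OF assms(2)] by simp
qed

lemma descent_lemma: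
  fixes f :: "'a::real_inner \<Rightarrow> real"
  assumes f: "\<And>z. GDERIV f z :> gf z" and lip: "L-lipschitz_on UNIV gf"
  shows "f b \<le> f a + gf a \<bullet> (b - a) + L / 2 * (norm (b - a))\<^sup>2"
proof -
  \<comment> \<open>\<open>\<phi> 1 \<le> \<phi> 0\<close> is the claim. The quadratic term is
    chosen so that its derivative \<open>L * s * (norm (b - a))\<^sup>2\<close> dominates the change
    of the gradient along the segment.\<close>
  define \<phi> where "\<phi> s = f (a + s *\<^sub>R (b - a)) - s * (gf a \<bullet> (b - a)) - L / 2 * s\<^sup>2 * (norm (b - a))\<^sup>2" for s
  have der: "(\<phi> has_real_derivative
      (gf (a + s *\<^sub>R (b - a)) \<bullet> (b - a) - gf a \<bullet> (b - a) - L * s * (norm (b - a))\<^sup>2)) (at s)" for s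
    unfolding \<phi>_def by (rule derivative_eq_intros GDERIV_line f refl | simp)+
  have "\<phi> 1 \<le> \<phi> 0"
  proof (rule DERIV_nonpos_imp_nonincreasing[of 0 1 \<phi>])
    fix s :: real assume s: "0 \<le> s" "s \<le> 1"
    have "(gf (a + s *\<^sub>R (b - a)) - gf a) \<bullet> (b - a) \<le> norm (gf (a + s *\<^sub>R (b - a)) - gf a) * norm (b - a)"
      by (rule norm_cauchy_schwarz)
    also have "\<dots> \<le> (L * norm (s *\<^sub>R (b - a))) * norm (b - a)"
      using lipschitz_on_normD[OF lip, of "a + s *\<^sub>R (b - a)" a] by (intro mult_right_mono) auto
    also have "\<dots> = L * s * (norm (b - a))\<^sup>2" using s by (simp add: power2_eq_square)
    finally show "\<exists>y. (\<phi> has_real_derivative y) (at s) \<and> y \<le> 0"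
      using der[of s] by (auto simp: inner_diff_left)
  qed simp
  then show ?thesis by (simp add: \<phi>_def)
qed

section \<open>Lower semicontinuity and existence of proximal points\<close>

lemma lower_semicontinuous_sequentially:
  fixes g :: "'a::topological_space \<Rightarrow> ereal"
  assumes lsc: "lower_semicontinuous g" and lim: "X \<longlonglongrightarrow> l"
    and bnd: "(\<lambda>n. b n) \<longlonglongrightarrow> B" "eventually (\<lambda>n. g (X n) \<le> b n) sequentially"
  shows "g l \<le> B"
proof (rule ccontr)
  assume "\<not> g l \<le> B"
  then obtain c where c: "B < c" "c < g l" by (metis dense not_le)
  have "c < Liminf (at l) g" using lsc c(2) by (auto simp: lower_semicontinuous_def intro: less_le_trans)
  \<comment> \<open>The \<open>Liminf\<close> is over a punctured neighbourhood;
    \<open>c < g l\<close> supplies the missing point.\<close>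
  from less_LiminfD[OF this] have "eventually (\<lambda>z. c < g z) (nhds l)"
    using c(2) by (auto simp: eventually_at_filter elim: eventually_mono)
  then have "eventually (\<lambda>n. c < g (X n)) sequentially"
    using lim by (auto simp: filterlim_iff)
  moreover have "eventually (\<lambda>n. b n < c) sequentially" using bnd(1) c(1) by (rule order_tendstoD)
  ultimately have "eventually (\<lambda>n. False) sequentially"
    using bnd(2) by eventually_elim auto
  then show False by simp
qed

text \<open>The parallelogram law centred at \<open>z\<close>; the last term measures the strong
  convexity of the squared distance.\<close>

lemma norm_midpoint_diff_square:
  fixes a b z :: "'a::real_inner"
  shows "(norm ((1 / 2) *\<^sub>R a + (1 / 2) *\<^sub>R b - z))\<^sup>2
    = (norm (a - z))\<^sup>2 / 2 + (norm (b - z))\<^sup>2 / 2 - (norm (a - b))\<^sup>2 / 4"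
  by (simp add: power2_norm_eq_inner inner_diff_left inner_diff_right inner_add_left inner_add_right
      inner_commute field_simps)

text \<open>
  The affine minorant bounds the objective from below, and its strong convexity makes minimising
  sequences Cauchy, so no weak compactness is needed.
\<close>

lemma prox_objective_attains_min:
  fixes g :: "'a::{real_inner, complete_space} \<Rightarrow> ereal"
  assumes proper: "proper_fun g" and lsc: "lower_semicontinuous g" and cvx: "convex_ereal_fun g"
    and minorant: "\<And>w. ereal (c + d \<bullet> w) \<le> g w" and q: "q > 0"
  shows "\<exists>p. \<forall>w. g p + ereal (q * (norm (p - z))\<^sup>2) \<le> g w + ereal (q * (norm (w - z))\<^sup>2)"
proof -
  define \<phi> where "\<phi> w = g w + ereal (q * (norm (w - z))\<^sup>2)" for w
  have notm: "g w \<noteq> -\<infinity>" for w using proper by (simp add: proper_fun_def)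
  have below: "ereal (c + d \<bullet> z - d \<bullet> d / (4 * q)) \<le> \<phi> w" for w
  proof -
    define u where "u = w - z"
    \<comment> \<open>Completing the square in \<open>u\<close> absorbs the linear term of the
      minorant.\<close>
    have "0 \<le> q * ((u + (1 / (2 * q)) *\<^sub>R d) \<bullet> (u + (1 / (2 * q)) *\<^sub>R d))"
      using q by simp
    also have "\<dots> = q * (u \<bullet> u) + d \<bullet> u + d \<bullet> d / (4 * q)"
      using q by (simp add: inner_add_left inner_add_right inner_commute[of u d] distrib_left)
    finally have "0 \<le> q * ((w - z) \<bullet> (w - z)) + d \<bullet> (w - z) + d \<bullet> d / (4 * q)"
      by (simp add: u_def)
    then have "c + d \<bullet> z - d \<bullet> d / (4 * q) \<le> (c + d \<bullet> w) + q * (norm (w - z))\<^sup>2"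
      by (simp add: power2_norm_eq_inner inner_diff_right)
    then show ?thesis unfolding \<phi>_def
      using add_right_mono[OF minorant[of w], of "ereal (q * (norm (w - z))\<^sup>2)"]
      by (simp add: order_trans[rotated])
  qed
  obtain w0 where "g w0 \<noteq> \<infinity>" using proper by (auto simp: proper_fun_def)
  then have "\<phi> w0 \<noteq> \<infinity>" by (simp add: \<phi>_def)
  then have "(INF w. \<phi> w) \<noteq> \<infinity>" using INF_lower[of w0 UNIV \<phi>] by auto
  moreover have "ereal (c + d \<bullet> z - d \<bullet> d / (4 * q)) \<le> (INF w. \<phi> w)"
    using below by (rule INF_greatest)
  then have "(INF w. \<phi> w) \<noteq> -\<infinity>" by auto
  ultimately obtain M where M: "(INF w. \<phi> w) = ereal M" by (cases "INF w. \<phi> w") auto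
  then have M_le: "ereal M \<le> \<phi> w" for w by (metis INF_lower UNIV_I)
  have "\<exists>w. \<phi> w < ereal (M + 1 / real (Suc n))" for n
    using M INF_less_iff[of \<phi> UNIV "ereal (M + 1 / real (Suc n))"] by auto
  then obtain X where X: "\<And>n. \<phi> (X n) < ereal (M + 1 / real (Suc n))" by metis
  have gX: "g (X n) \<le> ereal (M + 1 / real (Suc n) - q * (norm (X n - z))\<^sup>2)" for n
    using X[of n] notm[of "X n"] by (cases "g (X n)") (auto simp: \<phi>_def)
  \<comment> \<open>Convexity of \<open>g\<close> at the midpoint of two near-minimisers and the
    parallelogram law give \<open>M \<le> M + e - q / 4 * (norm (a - b))\<^sup>2\<close>.\<close>
  have close: "q / 4 * (norm (X m - X n))\<^sup>2 \<le> e"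
    if "1 / real (Suc m) \<le> e" "1 / real (Suc n) \<le> e" for m n e
  proof -
    define a b where "a = X m" and "b = X n"
    have ga: "g a \<le> ereal (M + e - q * (norm (a - z))\<^sup>2)"
      using gX[of m] that by (auto simp: a_def elim!: order_trans)
    have gb: "g b \<le> ereal (M + e - q * (norm (b - z))\<^sup>2)"
      using gX[of n] that by (auto simp: b_def elim!: order_trans)
    have "g ((1 - 1 / 2) *\<^sub>R a + (1 / 2) *\<^sub>R b) \<le> ereal (1 - 1 / 2) * g a + ereal (1 / 2) * g b"
      using cvx[unfolded convex_ereal_fun_def, rule_format, of "1 / 2" a b] by simp
    also have "\<dots> \<le> ereal (1 - 1 / 2) * ereal (M + e - q * (norm (a - z))\<^sup>2)
        + ereal (1 / 2) * ereal (M + e - q * (norm (b - z))\<^sup>2)"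
      using ga gb by (intro add_mono ereal_mult_left_mono) auto
    finally have gm: "g ((1 / 2) *\<^sub>R a + (1 / 2) *\<^sub>R b)
        \<le> ereal (M + e - q * (norm (a - z))\<^sup>2 / 2 - q * (norm (b - z))\<^sup>2 / 2)"
      by (simp add: field_simps)
    have "ereal M \<le> ereal (M + e - q * (norm (a - z))\<^sup>2 / 2 - q * (norm (b - z))\<^sup>2 / 2)
        + ereal (q * (norm ((1 / 2) *\<^sub>R a + (1 / 2) *\<^sub>R b - z))\<^sup>2)"
      using order_trans[OF M_le[of "(1 / 2) *\<^sub>R a + (1 / 2) *\<^sub>R b", unfolded \<phi>_def] add_right_mono[OF gm]] .
    then show ?thesis
      by (simp add: norm_midpoint_diff_square a_def b_def algebra_simps)
  qed
  have "Cauchy X"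
  proof (rule metric_CauchyI)
    fix e :: real assume e: "e > 0"
    then have "q / 4 * (e / 2)\<^sup>2 > 0" using q by simp
    then obtain N where N: "1 / real (Suc N) < q / 4 * (e / 2)\<^sup>2" using nat_approx_posE by metis
    have "dist (X m) (X n) < e" if "m \<ge> N" "n \<ge> N" for m n
    proof -
      have "1 / real (Suc m) \<le> 1 / real (Suc N)" "1 / real (Suc n) \<le> 1 / real (Suc N)"
        using that by (simp_all add: frac_le)
      then have "q / 4 * (norm (X m - X n))\<^sup>2 \<le> q / 4 * (e / 2)\<^sup>2"
        using N by (intro close) linarith+
      then have "(norm (X m - X n))\<^sup>2 \<le> (e / 2)\<^sup>2"
        by (rule mult_left_le_imp_le) (use q in simp)
      then have "norm (X m - X n) \<le> e / 2" by (rule power2_le_imp_le) (use e in simp)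
      then show ?thesis using e by (simp add: dist_norm)
    qed
    then show "\<exists>N. \<forall>m\<ge>N. \<forall>n\<ge>N. dist (X m) (X n) < e" by blast
  qed
  then obtain p where p: "X \<longlonglongrightarrow> p" using Cauchy_convergent convergent_def by blast
  have "(\<lambda>n. ereal (M + 1 / real (Suc n) - q * (norm (X n - z))\<^sup>2))
      \<longlonglongrightarrow> ereal (M + 0 - q * (norm (p - z))\<^sup>2)"
    by (intro tendsto_intros p LIMSEQ_Suc[OF lim_const_over_n])
  then have "g p \<le> ereal (M + 0 - q * (norm (p - z))\<^sup>2)"
    by (rule lower_semicontinuous_sequentially[OF lsc p]) (use gX in \<open>simp only: eventually_True simp_thms\<close>)
  then have "\<phi> p \<le> ereal M" unfolding \<phi>_def using notm[of p] by (cases "g p") auto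
  then show ?thesis using M_le unfolding \<phi>_def by (meson order_trans)
qed

lemma GDERIV_scaled_norm_square:
  "GDERIV (\<lambda>w. q * (norm (w - z))\<^sup>2) p :> (2 * q) *\<^sub>R (p - z)"
  unfolding gderiv_def power2_norm_eq_inner
  by (rule derivative_eq_intros refl | simp add: inner_commute algebra_simps)+

section \<open>Real sequences: telescoping and weighted energies\<close>

lemma telescoping_tendsto_0:
  fixes E w :: "nat \<Rightarrow> real"
  assumes "\<And>k. k \<ge> N \<Longrightarrow> E k \<ge> 0" "\<And>k. k \<ge> N \<Longrightarrow> w k \<ge> 0"
    and "\<And>k. k \<ge> N \<Longrightarrow> E (Suc k) + w k \<le> E k"
  shows "w \<longlonglongrightarrow> 0"
proof -
  define e where "e k = E (k + N)" for k
  have "e (Suc k) \<le> e k" for k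
    using assms(2,3)[of "k + N"] by (simp add: e_def)
  then have "decseq e" by (rule decseq_SucI)
  then obtain l where l: "e \<longlonglongrightarrow> l"
    using decseq_convergent[of e 0] assms(1) by (metis e_def le_add2)
  \<comment> \<open>The decrements of a convergent sequence tend to 0, and \<open>w\<close> lies
    between 0 and them.\<close>
  have "(\<lambda>k. e k - e (Suc k)) \<longlonglongrightarrow> l - l" by (intro tendsto_intros l LIMSEQ_Suc)
  then have lim: "(\<lambda>k. e k - e (Suc k)) \<longlonglongrightarrow> 0" by simp
  have "(\<lambda>k. w (k + N)) \<longlonglongrightarrow> 0"
  proof (rule tendsto_sandwich[OF _ _ tendsto_const lim])
    show "eventually (\<lambda>k. 0 \<le> w (k + N)) sequentially"
      using assms(2) by simp
    show "eventually (\<lambda>k. w (k + N) \<le> e k - e (Suc k)) sequentially"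
      using assms(3)[OF le_add2] by (simp add: e_def le_diff_eq add.commute)
  qed
  then show ?thesis by (rule LIMSEQ_offset)
qed

lemma nonincreasing_le_start:
  fixes E :: "nat \<Rightarrow> real"
  assumes "\<And>k. k \<ge> N \<Longrightarrow> E (Suc k) \<le> E k" "n \<ge> N"
  shows "E n \<le> E N"
  using assms(2) by (induction rule: dec_induct) (use assms(1) in \<open>auto intro: order_trans\<close>)

text \<open>The step bounds telescope to \<open>norm (u m - u k) \<le> h k - h m\<close>, which
  gives convergence and, as \<open>m\<close> grows, the rate. Here \<open>h\<close> serves as an
  explicit majorant of the tail sums.\<close>

lemma Cauchy_by_telescoping_majorant:
  fixes u :: "nat \<Rightarrow> 'a::{real_normed_vector, complete_space}"
  assumes step: "\<And>k. k \<ge> N \<Longrightarrow> norm (u (Suc k) - u k) \<le> h k - h (Suc k)" and h: "h \<longlonglongrightarrow> 0"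
  obtains l where "u \<longlonglongrightarrow> l" "\<And>k. k \<ge> N \<Longrightarrow> norm (u k - l) \<le> h k"
proof -
  have dist: "norm (u m - u k) \<le> h k - h m" if "k \<le> m" "N \<le> k" for m k
    using that(1)
  proof (induction rule: dec_induct)
    case (step n)
    then show ?case using norm_triangle_ineq[of "u (Suc n) - u n" "u n - u k"]
        assms(1)[of n] that(2) by auto
  qed simp
  have "Cauchy h" using h by (intro LIMSEQ_imp_Cauchy)
  have "Cauchy u"
  proof (rule metric_CauchyI)
    fix e :: real assume "e > 0"
    then obtain M where M: "\<And>m n. m \<ge> M \<Longrightarrow> n \<ge> M \<Longrightarrow> \<bar>h m - h n\<bar> < e"
      using metric_CauchyD[OF \<open>Cauchy h\<close>] unfolding dist_real_def by metis
    have "dist (u m) (u n) < e" if "m \<ge> max M N" "n \<ge> max M N" for m n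
      using dist[of m n] dist[of n m] M[of m n] that nat_le_linear[of m n]
      by (auto simp: dist_norm norm_minus_commute)
    then show "\<exists>M. \<forall>m\<ge>M. \<forall>n\<ge>M. dist (u m) (u n) < e" by blast
  qed
  then obtain l where l: "u \<longlonglongrightarrow> l" using Cauchy_convergent convergent_def by blast
  have "norm (u k - l) \<le> h k" if "k \<ge> N" for k
  proof -
    have "(\<lambda>m. norm (u m - u k)) \<longlonglongrightarrow> norm (l - u k)" by (intro tendsto_intros l)
    moreover have "(\<lambda>m. h k - h m) \<longlonglongrightarrow> h k - 0" by (intro tendsto_intros h)
    ultimately have "norm (l - u k) \<le> h k - 0"
      by (rule LIMSEQ_le) (use dist that in \<open>auto intro!: exI[of _ k]\<close>)
    then show ?thesis by (simp add: norm_minus_commute)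
  qed
  with l that show ?thesis by blast
qed

text \<open>Multiplying \<open>rec\<close> by \<open>(t (Suc k))\<^sup>2\<close> cancels the
  denominator of the inertial factor and leaves \<open>(t k - 1)\<^sup>2 \<le> (t k)\<^sup>2\<close>
  in front of \<open>\<delta> k\<close>. The growth of the weight on \<open>v\<close> is paid for by
  the surplus \<open>\<sigma>\<close>.\<close>

lemma inertial_energy_rates:
  fixes v \<delta> t :: "nat \<Rightarrow> real"
  assumes nonneg: "\<And>k. k \<ge> N \<Longrightarrow> v k \<ge> 0" "\<And>k. k \<ge> N \<Longrightarrow> \<delta> k \<ge> 0"
    and t: "\<And>k. k \<ge> N \<Longrightarrow> t k \<ge> 1" "(\<lambda>k. t (Suc k) / t k) \<longlonglongrightarrow> 1"
    and \<sigma>: "\<sigma> > 0"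
    and rec: "\<And>k. k \<ge> N \<Longrightarrow> (1 + \<sigma>) * v (Suc k) + \<delta> (Suc k) \<le> v k + ((t k - 1) / t (Suc k))\<^sup>2 * \<delta> k"
  shows "(\<lambda>k. (t k)\<^sup>2 * v k) \<longlonglongrightarrow> 0" "\<exists>B. \<forall>\<^sub>F k in sequentially. (t k)\<^sup>2 * \<delta> k \<le> B"
proof -
  have "(\<lambda>k. (t (Suc k) / t k)\<^sup>2) \<longlonglongrightarrow> 1\<^sup>2" by (intro tendsto_intros t)
  \<comment> \<open>Half of \<open>\<sigma>\<close> covers the growth of the weight; the other half
    remains as strict decrease.\<close>
  then have "eventually (\<lambda>k. (t (Suc k) / t k)\<^sup>2 < 1 + \<sigma> / 2) sequentially"
    using \<sigma> by (intro order_tendstoD) auto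
  then obtain M' where M': "\<And>k. k \<ge> M' \<Longrightarrow> (t (Suc k) / t k)\<^sup>2 < 1 + \<sigma> / 2"
    by (auto simp: eventually_sequentially)
  define M where "M = max M' N"
  define E where "E k = (1 + \<sigma>) * ((t k)\<^sup>2 * v k) + (t k)\<^sup>2 * \<delta> k" for k
  have E_nonneg: "E k \<ge> 0" if "k \<ge> M" for k
    using that nonneg \<sigma> by (simp add: E_def M_def)
  have dec: "E (Suc k) + \<sigma> / 2 * ((t k)\<^sup>2 * v k) \<le> E k" if k: "k \<ge> M" for k
  proof -
    have kN: "k \<ge> N" "k \<ge> M'" using k by (auto simp: M_def)
    have t1: "t k \<ge> 1" "t (Suc k) \<ge> 1" using t(1) kN by auto
    have "(t (Suc k))\<^sup>2 \<le> (1 + \<sigma> / 2) * (t k)\<^sup>2"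
      using M'[OF kN(2)] t1 by (simp add: power_divide pos_divide_less_eq)
    then have a: "(t (Suc k))\<^sup>2 * v k \<le> (1 + \<sigma> / 2) * (t k)\<^sup>2 * v k"
      using nonneg(1)[OF kN(1)] by (rule mult_right_mono)
    have "(t k - 1)\<^sup>2 \<le> (t k)\<^sup>2" using t1 by (intro power_mono) auto
    then have b: "(t k - 1)\<^sup>2 * \<delta> k \<le> (t k)\<^sup>2 * \<delta> k"
      using nonneg(2)[OF kN(1)] by (rule mult_right_mono)
    have "E (Suc k) = (t (Suc k))\<^sup>2 * ((1 + \<sigma>) * v (Suc k) + \<delta> (Suc k))"
      by (simp add: E_def algebra_simps)
    also have "\<dots> \<le> (t (Suc k))\<^sup>2 * (v k + ((t k - 1) / t (Suc k))\<^sup>2 * \<delta> k)"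
      using rec[OF kN(1)] by (intro mult_left_mono) auto
    also have "\<dots> = (t (Suc k))\<^sup>2 * v k + (t k - 1)\<^sup>2 * \<delta> k"
      using t1 by (simp add: power_divide distrib_left)
    finally show ?thesis using a b by (simp add: E_def algebra_simps)
  qed
  have "(\<lambda>k. \<sigma> / 2 * ((t k)\<^sup>2 * v k)) \<longlonglongrightarrow> 0"
    by (rule telescoping_tendsto_0[of M E]) (use E_nonneg dec nonneg \<sigma> in \<open>auto simp: M_def\<close>)
  from tendsto_mult_left[OF this, of "2 / \<sigma>"] show "(\<lambda>k. (t k)\<^sup>2 * v k) \<longlonglongrightarrow> 0" using \<sigma> by simp
  have E_step: "E (Suc k) \<le> E k" if "k \<ge> M" for k
  proof -
    have "0 \<le> \<sigma> / 2 * ((t k)\<^sup>2 * v k)" using nonneg \<sigma> that by (simp add: M_def)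
    then show ?thesis using dec[OF that] by linarith
  qed
  have "(t k)\<^sup>2 * \<delta> k \<le> E M" if "k \<ge> M" for k
  proof -
    have "0 \<le> (1 + \<sigma>) * ((t k)\<^sup>2 * v k)" using nonneg \<sigma> that by (simp add: M_def)
    then show ?thesis using nonincreasing_le_start[of M E, OF E_step that] by (simp add: E_def)
  qed
  then show "\<exists>B. \<forall>\<^sub>F k in sequentially. (t k)\<^sup>2 * \<delta> k \<le> B" by (auto simp: eventually_sequentially)
qed

section \<open>Asymptotics of the stretched exponential\<close>

lemma exp_powr_ratio_tendsto_1:
  fixes \<alpha> :: real
  assumes "0 < \<alpha>" "\<alpha> < 1"
  shows "(\<lambda>k. exp ((real (Suc k) - 1) powr \<alpha>) / exp ((real k - 1) powr \<alpha>)) \<longlonglongrightarrow> 1"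
  \<comment> \<open>Since \<open>\<alpha> < 1\<close>, the increments of
    \<open>(real k - 1) powr \<alpha>\<close> tend to 0.\<close>
  using assms by real_asymp

lemma powr_times_exp_neg_powr_tendsto_0:
  fixes \<alpha> :: real
  assumes "0 < \<alpha>" "\<alpha> < 1"
  shows "(\<lambda>k. (real k - 1) powr (1 - \<alpha>) * exp (- ((real k - 1) powr \<alpha>))) \<longlonglongrightarrow> 0"
  using assms by real_asymp

text \<open>
  The derivative of \<open>s powr (1 - \<alpha>) * exp (- (s powr \<alpha>))\<close> is asymptotically
  \<open>- \<alpha> * exp (- (s powr \<alpha>))\<close>, so this function telescopes the tail sums of the step sizes.
\<close>

lemma exp_neg_powr_le_increment:
  fixes \<alpha> :: real
  assumes "0 < \<alpha>" "\<alpha> < 1"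
  shows "\<forall>\<^sub>F k in sequentially. exp (- (real k powr \<alpha>)) \<le> 2 / \<alpha> *
    ((real k - 1) powr (1 - \<alpha>) * exp (- ((real k - 1) powr \<alpha>))
      - real k powr (1 - \<alpha>) * exp (- (real k powr \<alpha>)))"
  using assms by real_asymp

section \<open>Proximal points and forward-backward steps for the composite problem\<close>

locale composite_problem =
  fixes f :: "'a::{real_inner, complete_space} \<Rightarrow> real" and gf :: "'a \<Rightarrow> 'a"
    and g :: "'a \<Rightarrow> ereal" and L :: real and xs :: 'a
  assumes f_convex: "convex_on UNIV f"
    and f_gradient: "\<And>z. GDERIV f z :> gf z"
    and L_pos: "L > 0"
    and gradient_lipschitz: "L-lipschitz_on UNIV gf"
    and g_proper: "proper_fun g"
    and g_lsc: "lower_semicontinuous g"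
    and g_convex: "convex_ereal_fun g"
    and xs: "xs \<in> argmin_set (composite f g)"
begin

text \<open>The real numbers \<open>gr w\<close> and \<open>gap w\<close> are meaningful only where \<open>g\<close> is finite.\<close>

definition gr :: "'a \<Rightarrow> real" where "gr w = real_of_ereal (g w)"

definition gap :: "'a \<Rightarrow> real" where "gap w = f w + gr w - (f xs + gr xs)"

abbreviation fb :: "real \<Rightarrow> 'a \<Rightarrow> 'a" where "fb \<equiv> forward_backward gf g"

lemma g_not_MInf: "g w \<noteq> -\<infinity>"
  using g_proper by (simp add: proper_fun_def)

lemma g_eq_gr: "g w \<noteq> \<infinity> \<Longrightarrow> g w = ereal (gr w)"
  using g_not_MInf[of w] by (cases "g w") (auto simp: gr_def)

lemma composite_xs_le: "composite f g xs \<le> composite f g w"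
  using xs by (simp add: argmin_set_def)

lemma g_xs: "g xs = ereal (gr xs)"
proof (rule g_eq_gr)
  obtain w where "g w \<noteq> \<infinity>" using g_proper by (auto simp: proper_fun_def)
  then show "g xs \<noteq> \<infinity>" using composite_xs_le[of w] by (auto simp: composite_def)
qed

lemma argmin_iff: "z \<in> argmin_set (composite f g) \<longleftrightarrow> g z = ereal (gr z) \<and> gap z = 0"
proof
  assume z: "z \<in> argmin_set (composite f g)"
  then have eq: "composite f g z = composite f g xs"
    using composite_xs_le[of z] by (auto simp: argmin_set_def intro: antisym)
  then have "g z \<noteq> \<infinity>" using g_xs by (auto simp: composite_def)
  then show "g z = ereal (gr z) \<and> gap z = 0"
    using eq g_xs g_eq_gr[of z] by (auto simp: composite_def gap_def)
next
  assume "g z = ereal (gr z) \<and> gap z = 0"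
  then have "composite f g z = composite f g xs" using g_xs by (auto simp: composite_def gap_def)
  then show "z \<in> argmin_set (composite f g)" using xs by (simp add: argmin_set_def)
qed

lemma gap_nonneg:
  assumes "g w = ereal (gr w)"
  shows "gap w \<ge> 0"
  using composite_xs_le[of w] assms g_xs by (simp add: composite_def gap_def)

lemma prox_minimal:
  assumes "l > 0"
  shows "g (prox l g z) + ereal (1 / (2 * l) * (norm (prox l g z - z))\<^sup>2)
    \<le> g w + ereal (1 / (2 * l) * (norm (w - z))\<^sup>2)"
proof -
  \<comment> \<open>optimality of \<open>xs\<close> provides the affine minorant\<close>
  have "ereal (gr xs - gf xs \<bullet> (w - xs)) \<le> g w" for w
    by (rule convex_ereal_minimum_subgradient[OF g_convex g_not_MInf g_xs f_gradient])
       (use composite_xs_le in \<open>simp add: composite_def\<close>)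
  then have "ereal ((gr xs + gf xs \<bullet> xs) + (- gf xs) \<bullet> w) \<le> g w" for w
    by (simp add: inner_diff_right algebra_simps)
  from prox_objective_attains_min[OF g_proper g_lsc g_convex this, of "1 / (2 * l)" z] assms
  have "\<exists>p. is_arg_min (\<lambda>x. g x + ereal (1 / (2 * l) * (norm (x - z))\<^sup>2)) (\<lambda>_. True) p"
    by (auto simp: is_arg_min_def not_less)
  \<comment> \<open>\<open>arg_min\<close> is a choice operator, so existence of a minimiser makes
    the chosen point one.\<close>
  from someI_ex[OF this] show ?thesis
    by (simp add: prox_def arg_min_def is_arg_min_def not_less)
qed

lemma g_prox:
  assumes "l > 0"
  shows "g (prox l g z) = ereal (gr (prox l g z))"
  using prox_minimal[OF assms, of z xs] g_xs by (intro g_eq_gr) auto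

text \<open>First-order optimality of the proximal point \<open>p\<close>: the quadratic has
  gradient \<open>(1 / l) *\<^sub>R (p - z)\<close> there, so its negative is a subgradient of
  \<open>g\<close>.\<close>

lemma prox_variational:
  assumes "l > 0" and w: "g w = ereal (gr w)"
  shows "gr (prox l g z) + (1 / l) * ((z - prox l g z) \<bullet> (w - prox l g z)) \<le> gr w"
proof -
  define p where "p = prox l g z"
  have "ereal (gr p - ((2 * (1 / (2 * l))) *\<^sub>R (p - z)) \<bullet> (w - p)) \<le> g w"
    by (rule convex_ereal_minimum_subgradient[OF g_convex g_not_MInf _ GDERIV_scaled_norm_square])
       (use g_prox[OF assms(1), of z] prox_minimal[OF assms(1), of z] in \<open>simp_all add: p_def add.commute\<close>)
  then show ?thesis using w assms(1) by (simp add: p_def[symmetric] inner_diff_left algebra_simps diff_divide_distrib)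
qed

lemma g_fb: "l > 0 \<Longrightarrow> g (fb l a) = ereal (gr (fb l a))"
  by (simp add: forward_backward_def g_prox)

lemma fb_variational:
  assumes "l > 0" "g w = ereal (gr w)"
  shows "gr (fb l a) + (1 / l) * ((a - fb l a) \<bullet> (w - fb l a)) - gf a \<bullet> (w - fb l a) \<le> gr w"
  using prox_variational[OF assms, of "a - l *\<^sub>R gf a"] assms(1)
  by (simp add: forward_backward_def inner_diff_left inner_add_left algebra_simps diff_divide_distrib
      add_divide_distrib)

text \<open>Sum of the descent lemma and the gradient inequality for \<open>f\<close> at
  \<open>a\<close>, the optimality of the proximal point, and the expansion of
  \<open>(norm (w - a))\<^sup>2\<close> around that point. It is applied with \<open>w\<close> the
  previous iterate and with \<open>w\<close> a minimiser.\<close>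

lemma fb_descent:
  assumes l: "l > 0" and w: "g w = ereal (gr w)"
  shows "gap (fb l a) + (norm (w - fb l a))\<^sup>2 / (2 * l) + (1 - l * L) / (2 * l) * (norm (fb l a - a))\<^sup>2
    \<le> gap w + (norm (w - a))\<^sup>2 / (2 * l)"
proof -
  define p where "p = fb l a"
  have 1: "f p \<le> f a + gf a \<bullet> (p - a) + L / 2 * (norm (p - a))\<^sup>2"
    by (rule descent_lemma[OF f_gradient gradient_lipschitz])
  have 2: "f a + gf a \<bullet> (w - a) \<le> f w"
    by (rule convex_gradient_inequality[OF f_convex f_gradient])
  have 3: "gr p + (1 / l) * ((a - p) \<bullet> (w - p)) - gf a \<bullet> (w - p) \<le> gr w"
    unfolding p_def by (rule fb_variational[OF l w])
  have "(norm (w - a))\<^sup>2 = (norm (w - p))\<^sup>2 + (norm (p - a))\<^sup>2 - 2 * ((a - p) \<bullet> (w - p))"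
    by (simp add: power2_norm_eq_inner inner_diff_left inner_diff_right inner_commute)
  then have 4: "(norm (w - a))\<^sup>2 / (2 * l) = (norm (w - p))\<^sup>2 / (2 * l) + (norm (p - a))\<^sup>2 / (2 * l)
      - (1 / l) * ((a - p) \<bullet> (w - p))"
    by (simp add: add_divide_distrib diff_divide_distrib)
  have 5: "(1 - l * L) / (2 * l) * (norm (p - a))\<^sup>2 = (norm (p - a))\<^sup>2 / (2 * l) - L / 2 * (norm (p - a))\<^sup>2"
    using l by (simp add: field_simps)
  have 6: "gf a \<bullet> (w - a) = gf a \<bullet> (p - a) + gf a \<bullet> (w - p)" by (simp add: inner_diff_right)
  show ?thesis using 1 2 3 4 5 6 unfolding p_def[symmetric] gap_def by linarith
qed

text \<open>Adding the variational inequalities of the two proximal points cancels the values of \<open>g\<close>.\<close>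

lemma fb_residual_le:
  assumes l: "l > 0"
  shows "norm (fb (1 / L) (fb l a) - fb l a) \<le> (1 + 1 / (L * l)) * norm (fb l a - a)"
proof -
  define p where "p = fb l a"
  define q where "q = fb (1 / L) p"
  have gp: "g p = ereal (gr p)" and gq: "g q = ereal (gr q)"
    using l L_pos by (auto simp: p_def q_def g_fb)
  have 1: "gr q + L * ((p - q) \<bullet> (p - q)) - gf p \<bullet> (p - q) \<le> gr p"
    using fb_variational[of "1 / L" p p] L_pos gp by (simp add: q_def)
  have 2: "gr p + (1 / l) * ((a - p) \<bullet> (q - p)) - gf a \<bullet> (q - p) \<le> gr q"
    using fb_variational[of l q a] l gq by (simp add: p_def)
  have "L * (norm (p - q))\<^sup>2 \<le> (gf p - gf a + (1 / l) *\<^sub>R (a - p)) \<bullet> (p - q)"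
    using 1 2 by (simp add: power2_norm_eq_inner inner_add_left inner_diff_left inner_diff_right
        inner_commute algebra_simps)
  also have "\<dots> \<le> norm (gf p - gf a + (1 / l) *\<^sub>R (a - p)) * norm (p - q)" by (rule norm_cauchy_schwarz)
  also have "\<dots> \<le> (L * norm (p - a) + (1 / l) * norm (p - a)) * norm (p - q)"
  proof (rule mult_right_mono)
    have "norm (gf p - gf a) \<le> L * norm (p - a)" by (rule lipschitz_on_normD[OF gradient_lipschitz]) auto
    moreover have "norm ((1 / l) *\<^sub>R (a - p)) = (1 / l) * norm (p - a)"
      using l by (simp add: norm_minus_commute)
    ultimately show "norm (gf p - gf a + (1 / l) *\<^sub>R (a - p)) \<le> L * norm (p - a) + (1 / l) * norm (p - a)"
      using norm_triangle_ineq[of "gf p - gf a" "(1 / l) *\<^sub>R (a - p)"] by linarith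
  qed simp
  also have "\<dots> = L * ((1 + 1 / (L * l)) * norm (p - a) * norm (p - q))"
    using L_pos l by (simp add: field_simps)
  finally have le: "norm (p - q) * norm (p - q) \<le> (1 + 1 / (L * l)) * norm (p - a) * norm (p - q)"
    using L_pos by (simp add: power2_eq_square)
  have "norm (p - q) \<le> (1 + 1 / (L * l)) * norm (p - a)"
  proof (cases "norm (p - q) = 0")
    case True
    then show ?thesis using L_pos l by simp
  next
    case False
    with le show ?thesis using mult_le_cancel_right_pos by (metis zero_less_norm_iff norm_eq_zero)
  qed
  then show ?thesis by (simp add: p_def q_def norm_minus_commute)
qed

text \<open>Comparison with a minimiser \<open>z\<close> and the triangle inequality bound the gap
  linearly in \<open>dist p z\<close>. Passing to the infimum over \<open>z\<close> replaces this
  distance by \<open>infdist\<close> without choosing a nearest point.\<close>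

lemma fb_gap_le:
  assumes l: "l > 0" "l * L \<le> 1" and dist: "infdist (fb l a) (argmin_set (composite f g)) \<le> \<rho> * norm (fb l a - a)"
  shows "gap (fb l a) \<le> (1 + 2 * \<rho>) / (2 * l) * (norm (fb l a - a))\<^sup>2"
proof -
  define p where "p = fb l a"
  define n where "n = norm (p - a)"
  have le: "2 * l * gap p - n\<^sup>2 \<le> 2 * n * dist p z" if z: "z \<in> argmin_set (composite f g)" for z
  proof -
    have "gap p + (norm (z - p))\<^sup>2 / (2 * l) + (1 - l * L) / (2 * l) * n\<^sup>2 \<le> (norm (z - a))\<^sup>2 / (2 * l)"
      using fb_descent[OF l(1), of z a] z by (simp add: argmin_iff p_def n_def)
    moreover have "(1 - l * L) / (2 * l) * n\<^sup>2 \<ge> 0" using l by simp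
    ultimately have "gap p \<le> ((norm (z - a))\<^sup>2 - (norm (z - p))\<^sup>2) / (2 * l)"
      by (simp add: diff_divide_distrib)
    then have "2 * l * gap p \<le> (norm (z - a))\<^sup>2 - (norm (z - p))\<^sup>2"
      using l by (simp add: field_simps)
    moreover have "(norm (z - a))\<^sup>2 \<le> (norm (z - p) + n)\<^sup>2"
      using norm_triangle_ineq[of "z - p" "p - a"] by (intro power_mono) (auto simp: n_def)
    ultimately show ?thesis by (simp add: dist_norm norm_minus_commute power2_sum algebra_simps)
  qed
  \<comment> \<open>Dividing by \<open>2 * n\<close> isolates the distance before taking the
    infimum, hence the separate case \<open>n = 0\<close>.\<close>
  have "2 * l * gap p - n\<^sup>2 \<le> 2 * n * (\<rho> * n)"
  proof (cases "n = 0")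
    case True
    then show ?thesis using le[OF xs] by simp
  next
    case False
    then have n: "n > 0" by (simp add: n_def)
    then have "(2 * l * gap p - n\<^sup>2) / (2 * n) \<le> dist p z" if "z \<in> argmin_set (composite f g)" for z
      using le[OF that] by (simp add: pos_divide_le_eq mult.commute)
    then have "(2 * l * gap p - n\<^sup>2) / (2 * n) \<le> infdist p (argmin_set (composite f g))"
      using xs by (auto simp: infdist_def intro!: cINF_greatest)
    then have "(2 * l * gap p - n\<^sup>2) / (2 * n) \<le> \<rho> * n" using dist by (simp add: p_def n_def)
    then show ?thesis using n by (simp add: pos_divide_le_eq mult.commute)
  qed
  then have "gap p \<le> (1 + 2 * \<rho>) / (2 * l) * n\<^sup>2" using l by (simp add: field_simps power2_eq_square)
  then show ?thesis by (simp add: p_def n_def)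
qed

text \<open>By continuity of \<open>f\<close>, the values \<open>g (X k)\<close>, written as gap
  minus \<open>f (X k)\<close> plus the optimal value, converge to the optimal value minus
  \<open>f l\<close>; lower semicontinuity bounds \<open>g l\<close> by this limit.\<close>

lemma gap_tendsto_0_limit_in_argmin:
  assumes X: "X \<longlonglongrightarrow> l" and fin: "\<And>k. k \<ge> N \<Longrightarrow> g (X k) = ereal (gr (X k))"
    and gap: "(\<lambda>k. gap (X k)) \<longlonglongrightarrow> 0"
  shows "l \<in> argmin_set (composite f g)"
proof -
  have "isCont f l" using GDERIV_DERIV_compose f_gradient[of l] has_derivative_continuous
    unfolding gderiv_def by blast
  then have f: "(\<lambda>k. f (X k)) \<longlonglongrightarrow> f l" using X by (rule isCont_tendsto_compose)
  have "(\<lambda>k. ereal (gap (X k) - f (X k) + (f xs + gr xs))) \<longlonglongrightarrow> ereal (0 - f l + (f xs + gr xs))"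
    by (intro tendsto_intros gap f)
  then have "g l \<le> ereal (0 - f l + (f xs + gr xs))"
    by (rule lower_semicontinuous_sequentially[OF g_lsc X])
       (use fin in \<open>auto simp: gap_def eventually_sequentially intro!: exI[of _ N]\<close>)
  then have "composite f g l \<le> composite f g xs"
    using g_xs by (cases "g l") (auto simp: composite_def)
  then show ?thesis using xs by (auto simp: argmin_set_def intro: order_trans)
qed


section \<open>The inertial iteration for general nondecreasing \<open>t\<close> with ratio tending
  to 1\<close>

lemma inertial_rates:
  assumes \<mu>: "0 < \<mu>" "\<mu> < 1"
    and t: "\<And>k. k \<ge> 1 \<Longrightarrow> t k \<ge> 1" "\<And>k. k \<ge> 1 \<Longrightarrow> t k \<le> t (Suc k)" "(\<lambda>k. t (Suc k) / t k) \<longlonglongrightarrow> 1"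
    and error_bound: "local_error_bound f gf g L"
    and algorithm: "inertial_forward_backward gf g (\<mu> / L) t x0 x y"
  shows "(\<lambda>k. (t k)\<^sup>2 * gap (x k)) \<longlonglongrightarrow> 0"
    and "\<exists>D. \<forall>\<^sub>F k in sequentially. t k * norm (x k - x (k - 1)) \<le> D"
proof -
  define l where "l = \<mu> / L"
  have l: "l > 0" "l * L = \<mu>" using \<mu> L_pos by (simp_all add: l_def)
  have x: "x k = fb l (y k)" if "k \<ge> 1" for k
    using algorithm that by (simp add: inertial_forward_backward_def l_def)
  have y: "y (Suc k) = x k + ((t k - 1) / t (Suc k)) *\<^sub>R (x k - x (k - 1))" if "k \<ge> 1" for k
    using algorithm that by (simp add: inertial_forward_backward_def)
  have fin: "g (x k) = ereal (gr (x k))" if "k \<ge> 1" for k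
    using x[OF that] g_fb[OF l(1)] by simp
  define v where "v k = gap (x k)" for k
  define \<delta> where "\<delta> k = (norm (x k - x (k - 1)))\<^sup>2 / (2 * l)" for k
  define n where "n k = norm (x k - y k)" for k
  define c where "c = (1 - \<mu>) / (2 * l)"
  have c: "c > 0" using \<mu> l by (simp add: c_def)
  have nonneg: "v k \<ge> 0" "\<delta> k \<ge> 0" if "k \<ge> 1" for k
    using gap_nonneg[OF fin[OF that]] l by (simp_all add: v_def \<delta>_def)
  have descent: "v (Suc k) + \<delta> (Suc k) + c * (n (Suc k))\<^sup>2 \<le> v k + ((t k - 1) / t (Suc k))\<^sup>2 * \<delta> k"
    if "k \<ge> 1" for k
  proof -
    have "norm (x k - y (Suc k)) = \<bar>(t k - 1) / t (Suc k)\<bar> * norm (x k - x (k - 1))"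
      by (simp add: y[OF that])
    then have "(norm (x k - y (Suc k)))\<^sup>2 / (2 * l) = ((t k - 1) / t (Suc k))\<^sup>2 * \<delta> k"
      by (simp add: \<delta>_def power_mult_distrib power_divide)
    moreover have "v (Suc k) + \<delta> (Suc k) + c * (n (Suc k))\<^sup>2 \<le> v k + (norm (x k - y (Suc k)))\<^sup>2 / (2 * l)"
      using fb_descent[OF l(1) fin[OF that], of "y (Suc k)"] x[of "Suc k"] l(2)
      by (simp add: v_def \<delta>_def n_def c_def norm_minus_commute)
    ultimately show ?thesis by (simp only:)
  qed
  \<comment> \<open>The inertial coefficient lies in \<open>[0, 1]\<close> because
    \<open>1 \<le> t k \<le> t (Suc k)\<close>.\<close>
  have energy: "(v (Suc k) + \<delta> (Suc k)) + c * (n (Suc k))\<^sup>2 \<le> v k + \<delta> k" if "k \<ge> 1" for k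
  proof -
    have "\<bar>(t k - 1) / t (Suc k)\<bar> \<le> 1"
      using t(1)[OF that] t(2)[OF that] by (simp add: pos_divide_le_eq)
    then have "((t k - 1) / t (Suc k))\<^sup>2 * \<delta> k \<le> \<delta> k"
      using nonneg[OF that] by (intro mult_left_le_one_le) (simp_all add: abs_square_le_1)
    then show ?thesis using descent[OF that] by linarith
  qed
  have energy_le: "v (Suc k) + \<delta> (Suc k) \<le> v k + \<delta> k" if "k \<ge> 1" for k
  proof -
    have "c * (n (Suc k))\<^sup>2 \<ge> 0" using c by simp
    then show ?thesis using energy[OF that] by linarith
  qed
  have n_lim: "(\<lambda>k. c * (n (Suc k))\<^sup>2) \<longlonglongrightarrow> 0"
    by (rule telescoping_tendsto_0[of 1 "\<lambda>k. v k + \<delta> k"])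
       (use nonneg energy c in \<open>simp_all add: add_nonneg_nonneg\<close>)

  \<comment> \<open>The energy at index 1 fixes a sublevel set containing all later iterates. Index
    0 cannot serve, as \<open>g x0\<close> may be infinite.\<close>
  define \<xi> where "\<xi> = f xs + gr xs + (v 1 + \<delta> 1)"
  have "composite f g xs \<le> ereal \<xi>"
    using nonneg[of 1] g_xs by (simp add: composite_def \<xi>_def)
  then have "(INF z. composite f g z) \<le> ereal \<xi>"
    by (meson INF_lower UNIV_I order_trans)
  then obtain \<epsilon> \<tau> where \<epsilon>: "\<epsilon> > 0" and \<tau>: "\<tau> > 0" and bound: "\<And>w. norm (fb (1 / L) w - w) < \<epsilon>
      \<Longrightarrow> composite f g w \<le> ereal \<xi> \<Longrightarrow> infdist w (argmin_set (composite f g)) \<le> \<tau> * norm (fb (1 / L) w - w)"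
    using error_bound unfolding local_error_bound_def by meson
  have level: "composite f g (x k) \<le> ereal \<xi>" if "k \<ge> 1" for k
  proof -
    have "v k + \<delta> k \<le> v 1 + \<delta> 1"
      using nonincreasing_le_start[of 1 "\<lambda>k. v k + \<delta> k", OF energy_le that] .
    then show ?thesis
      using nonneg(2)[OF that] fin[OF that] by (simp add: composite_def \<xi>_def v_def gap_def)
  qed
  \<comment> \<open>The error bound concerns step size \<open>1 / L\<close>, the iteration uses
    \<open>\<mu> / L\<close>; \<open>\<kappa>\<close> converts between the residuals.\<close>
  define \<kappa> where "\<kappa> = 1 + 1 / (L * l)"
  have \<kappa>: "\<kappa> > 0" using L_pos l by (simp add: \<kappa>_def add_pos_pos)
  define C where "C = (1 + 2 * (\<tau> * \<kappa>)) / (2 * l)"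
  have C: "C > 0" using \<tau> \<kappa> l by (simp add: C_def add_pos_pos)
  have "eventually (\<lambda>k. c * (n (Suc k))\<^sup>2 < c * (\<epsilon> / \<kappa>)\<^sup>2) sequentially"
    by (rule order_tendstoD(2)[OF n_lim]) (use c \<epsilon> \<kappa> in simp)
  then obtain M where M: "\<And>k. k \<ge> M \<Longrightarrow> c * (n (Suc k))\<^sup>2 < c * (\<epsilon> / \<kappa>)\<^sup>2"
    by (auto simp: eventually_sequentially)
  define N where "N = max M 1"
  have gap_le: "v (Suc k) \<le> C * (n (Suc k))\<^sup>2" if "k \<ge> N" for k
  proof -
    have "(n (Suc k))\<^sup>2 < (\<epsilon> / \<kappa>)\<^sup>2"
      by (rule mult_left_less_imp_less[of c]) (use M[of k] that c in \<open>simp_all add: N_def\<close>)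
    then have "n (Suc k) < \<epsilon> / \<kappa>" by (rule power2_less_imp_less) (use \<epsilon> \<kappa> in simp)
    then have small: "\<kappa> * n (Suc k) < \<epsilon>" using \<kappa> by (simp add: pos_less_divide_eq mult.commute)
    have res: "norm (fb (1 / L) (x (Suc k)) - x (Suc k)) \<le> \<kappa> * n (Suc k)"
      using fb_residual_le[OF l(1), of "y (Suc k)"] by (simp add: x n_def \<kappa>_def)
    have "infdist (x (Suc k)) (argmin_set (composite f g)) \<le> \<tau> * norm (fb (1 / L) (x (Suc k)) - x (Suc k))"
      using res small level by (intro bound) auto
    also have "\<dots> \<le> \<tau> * (\<kappa> * n (Suc k))" using res \<tau> by (intro mult_left_mono) auto
    finally show ?thesis
      using fb_gap_le[of l "y (Suc k)" "\<tau> * \<kappa>"] l \<mu> by (simp add: x n_def v_def C_def mult.assoc)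
  qed
  \<comment> \<open>The residual term of the descent inequality, bounded below through
    \<open>gap_le\<close>, supplies the surplus \<open>c / C\<close>.\<close>
  have rec: "(1 + c / C) * v (Suc k) + \<delta> (Suc k) \<le> v k + ((t k - 1) / t (Suc k))\<^sup>2 * \<delta> k"
    if "k \<ge> N" for k
  proof -
    have "c / C * v (Suc k) \<le> c / C * (C * (n (Suc k))\<^sup>2)"
      using gap_le[OF that] c C by (intro mult_left_mono) auto
    then have "c / C * v (Suc k) \<le> c * (n (Suc k))\<^sup>2" using C by simp
    then show ?thesis using descent[of k] that by (simp add: N_def distrib_right)
  qed
  have N1: "k \<ge> 1" if "k \<ge> N" for k using that by (simp add: N_def)
  note rates = inertial_energy_rates[of N v \<delta> t "c / C", OF nonneg(1)[OF N1] nonneg(2)[OF N1] t(1)[OF N1] t(3) _ rec]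
  show "(\<lambda>k. (t k)\<^sup>2 * gap (x k)) \<longlonglongrightarrow> 0" using rates(1) c C by (simp add: v_def)
  obtain B where B: "\<forall>\<^sub>F k in sequentially. (t k)\<^sup>2 * \<delta> k \<le> B" using rates(2) c C by auto
  have "\<forall>\<^sub>F k in sequentially. t k * norm (x k - x (k - 1)) \<le> sqrt (2 * l * B)"
    using B
  proof eventually_elim
    case (elim k)
    then show ?case using l by (intro real_le_rsqrt) (simp add: \<delta>_def power_mult_distrib field_simps)
  qed
  then show "\<exists>D. \<forall>\<^sub>F k in sequentially. t k * norm (x k - x (k - 1)) \<le> D" by blast
qed

end

section \<open>Specialisation to the stretched exponential sequence\<close>

theorem corollary3p1:
  fixes f :: "'a::{real_inner, complete_space} \<Rightarrow> real"
    and gf :: "'a \<Rightarrow> 'a"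
    and g :: "'a \<Rightarrow> ereal"
    and L \<mu> \<alpha> :: real
    and t :: "nat \<Rightarrow> real"
    and x y :: "nat \<Rightarrow> 'a"
    and x0 xs :: 'a
  assumes f_convex: "convex_on UNIV f"
    and f_gradient: "\<And>z. GDERIV f z :> gf z"
    and L_pos: "L > 0"
    and gradient_lipschitz: "L-lipschitz_on UNIV gf"
    and g_proper: "proper_fun g"
    and g_lsc: "lower_semicontinuous g"
    and g_convex: "convex_ereal_fun g"
    and mu: "0 < \<mu>" "\<mu> < 1"
    and alpha: "0 < \<alpha>" "\<alpha> < 1"
    and t_def: "\<And>k. k \<ge> 1 \<Longrightarrow> t k = exp ((real k - 1) powr \<alpha>)"
    and error_bound: "local_error_bound f gf g L"
    and algorithm: "inertial_forward_backward gf g (\<mu> / L) t x0 x y"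
    and xs: "xs \<in> argmin_set (composite f g)"
  shows "(\<forall>k\<ge>1. composite f g (x k) < \<infinity>)
    \<and> (\<lambda>k. real_of_ereal (composite f g (x k)) - real_of_ereal (composite f g xs))
        \<in> o(\<lambda>k. 1 / exp (2 * (real k - 1) powr \<alpha>))
    \<and> (\<lambda>k. norm (x k - x (k - 1))) \<in> O(\<lambda>k. 1 / exp ((real k - 1) powr \<alpha>))
    \<and> (\<exists>xbar \<in> argmin_set (composite f g).
          x \<longlonglongrightarrow> xbar
        \<and> (\<lambda>k. norm (x k - xbar))
            \<in> O(\<lambda>k. (real k - 1) powr (\<alpha> * of_int \<lceil>1 / \<alpha> - 1\<rceil>)
                     * exp (- ((real k - 1) powr \<alpha>))))"
proof -
  interpret composite_problem f gf g L xs
    by unfold_locales (fact f_convex f_gradient L_pos gradient_lipschitz g_proper g_lsc g_convex xs)+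
  \<comment> \<open>\<open>t\<close> is prescribed only from index 1 on; \<open>e\<close> uses the
    formula at every index.\<close>
  define e where "e k = exp ((real k - 1) powr \<alpha>)" for k
  have e: "e k > 0" for k by (simp add: e_def)
  have t_e: "t k = e k" if "k \<ge> 1" for k using t_def[OF that] by (simp add: e_def)
  have t_ge: "t k \<ge> 1" if "k \<ge> 1" for k using t_def[OF that] by simp
  have t_mono: "t k \<le> t (Suc k)" if "k \<ge> 1" for k
    using that alpha by (simp add: t_def powr_mono2)
  have ev_t: "eventually (\<lambda>k. t k = e k) sequentially"
    using eventually_ge_at_top[of 1] by eventually_elim (rule t_e)
  have "(\<lambda>k. e (Suc k) / e k) \<longlonglongrightarrow> 1" unfolding e_def by (rule exp_powr_ratio_tendsto_1[OF alpha])
  then have t_ratio: "(\<lambda>k. t (Suc k) / t k) \<longlonglongrightarrow> 1"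
    by (rule Lim_transform_eventually) (use eventually_ge_at_top[of 1] in eventually_elim, simp add: t_e)
  have rates: "(\<lambda>k. (t k)\<^sup>2 * gap (x k)) \<longlonglongrightarrow> 0"
      "\<exists>D. \<forall>\<^sub>F k in sequentially. t k * norm (x k - x (k - 1)) \<le> D"
    using inertial_rates[OF mu t_ge t_mono t_ratio error_bound algorithm] by blast+
  have fin: "g (x k) = ereal (gr (x k))" if "k \<ge> 1" for k
    using algorithm that g_fb[of "\<mu> / L" "y k"] mu L_pos by (simp add: inertial_forward_backward_def)
  \<comment> \<open>\<open>real_of_ereal\<close> sends infinity to 0, so finiteness gives the
    real-valued rate its meaning.\<close>
  have finite: "\<forall>k\<ge>1. composite f g (x k) < \<infinity>" using fin by (auto simp: composite_def)
  have gap_eq: "eventually (\<lambda>k. gap (x k)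
      = real_of_ereal (composite f g (x k)) - real_of_ereal (composite f g xs)) sequentially"
    using eventually_ge_at_top[of 1]
    by eventually_elim (metis composite_def fin g_xs gap_def plus_ereal.simps(1) real_of_ereal.simps(1))

  have "(\<lambda>k. (e k)\<^sup>2 * gap (x k)) \<longlonglongrightarrow> 0"
    by (rule Lim_transform_eventually[OF rates(1)]) (use ev_t in eventually_elim, simp)
  then have "(\<lambda>k. gap (x k) / (1 / (e k)\<^sup>2)) \<longlonglongrightarrow> 0" by (simp add: mult.commute)
  then have "(\<lambda>k. gap (x k)) \<in> o(\<lambda>k. 1 / (e k)\<^sup>2)"
    by (rule smalloI_tendsto) (use e in \<open>simp add: less_imp_neq[symmetric]\<close>)
  then have value_rate: "(\<lambda>k. real_of_ereal (composite f g (x k)) - real_of_ereal (composite f g xs))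
      \<in> o(\<lambda>k. 1 / exp (2 * (real k - 1) powr \<alpha>))"
    using landau_o.small.in_cong[OF gap_eq] by (simp add: e_def exp_double)

  obtain D where "\<forall>\<^sub>F k in sequentially. t k * norm (x k - x (k - 1)) \<le> D" using rates(2) by blast
  then have step: "eventually (\<lambda>k. norm (x k - x (k - 1)) \<le> D * (1 / e k)) sequentially"
    using ev_t by eventually_elim (use e in \<open>simp add: pos_le_divide_eq mult.commute\<close>)
  then have steps: "(\<lambda>k. norm (x k - x (k - 1))) \<in> O(\<lambda>k. 1 / exp ((real k - 1) powr \<alpha>))"
    by (intro bigoI[of _ D]) (simp add: e_def)

  \<comment> \<open>The increment estimate at \<open>k\<close> bounds \<open>1 / e (Suc k)\<close>,
    matching the step from \<open>x k\<close> to \<open>x (Suc k)\<close>.\<close>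
  define h where "h k = D * (2 / \<alpha>) * ((real k - 1) powr (1 - \<alpha>) * exp (- ((real k - 1) powr \<alpha>)))" for k
  have "eventually (\<lambda>k. norm (x (Suc k) - x k) \<le> D * (1 / e (Suc k))) sequentially"
    using step eventually_sequentially_Suc[of "\<lambda>k. norm (x k - x (k - 1)) \<le> D * (1 / e k)"] by simp
  then have "eventually (\<lambda>k. norm (x (Suc k) - x k) \<le> h k - h (Suc k)) sequentially"
    using exp_neg_powr_le_increment[OF alpha]
  proof eventually_elim
    case (elim k)
    \<comment> \<open>\<open>D\<close> comes with no sign; a norm bounded by
      \<open>D / e (Suc k)\<close> forces it to be nonnegative.\<close>
    have "0 \<le> D / e (Suc k)" using order_trans[OF norm_ge_zero elim(1)] by simp
    then have "D \<ge> 0" using e[of "Suc k"] by (simp add: zero_le_divide_iff)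
    from mult_left_mono[OF elim(2) this] elim(1) show ?case
      by (simp add: h_def e_def exp_minus divide_inverse algebra_simps)
  qed
  then obtain N where N: "\<And>k. k \<ge> N \<Longrightarrow> norm (x (Suc k) - x k) \<le> h k - h (Suc k)"
    by (auto simp: eventually_sequentially)
  have "h \<longlonglongrightarrow> 0"
    unfolding h_def by (rule tendsto_mult_right_zero[OF powr_times_exp_neg_powr_tendsto_0[OF alpha]])
  from Cauchy_by_telescoping_majorant[OF N this]
  obtain xbar where lim: "x \<longlonglongrightarrow> xbar" and dist: "\<And>k. k \<ge> N \<Longrightarrow> norm (x k - xbar) \<le> h k"
    by blast

  have "(\<lambda>k. gap (x k)) \<longlonglongrightarrow> 0"
  proof (rule tendsto_sandwich[OF _ _ tendsto_const rates(1)])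
    show "eventually (\<lambda>k. 0 \<le> gap (x k)) sequentially"
      using eventually_ge_at_top[of 1] by eventually_elim (rule gap_nonneg[OF fin])
    show "eventually (\<lambda>k. gap (x k) \<le> (t k)\<^sup>2 * gap (x k)) sequentially"
      using eventually_ge_at_top[of 1]
    proof eventually_elim
      case (elim k)
      then have "(t k)\<^sup>2 \<ge> 1" using t_ge one_le_power by blast
      then show ?case using gap_nonneg[OF fin[OF elim]] mult_right_mono by fastforce
    qed
  qed
  then have xbar: "xbar \<in> argmin_set (composite f g)"
    using gap_tendsto_0_limit_in_argmin[OF lim fin] by blast

  have "(\<lambda>k. norm (x k - xbar)) \<in> O(\<lambda>k. (real k - 1) powr (\<alpha> * of_int \<lceil>1 / \<alpha> - 1\<rceil>)
      * exp (- ((real k - 1) powr \<alpha>)))"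
  proof (rule bigoI)
    have "\<alpha> * (1 / \<alpha> - 1) \<le> \<alpha> * of_int \<lceil>1 / \<alpha> - 1\<rceil>"
      using alpha by (intro mult_left_mono) auto
    then have exponent: "1 - \<alpha> \<le> \<alpha> * of_int \<lceil>1 / \<alpha> - 1\<rceil>"
      using alpha by (simp add: right_diff_distrib)
    show "eventually (\<lambda>k. norm (norm (x k - xbar)) \<le> \<bar>D * (2 / \<alpha>)\<bar>
        * norm ((real k - 1) powr (\<alpha> * of_int \<lceil>1 / \<alpha> - 1\<rceil>) * exp (- ((real k - 1) powr \<alpha>)))) sequentially"
      \<comment> \<open>From \<open>k = 2\<close> on the base \<open>real k - 1\<close> is at least
        1, so \<open>powr\<close> is monotone in the exponent.\<close>
      using eventually_ge_at_top[of "max N 2"]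
    proof eventually_elim
      case (elim k)
      have "norm (x k - xbar) \<le> \<bar>D * (2 / \<alpha>)\<bar> * ((real k - 1) powr (1 - \<alpha>) * exp (- ((real k - 1) powr \<alpha>)))"
        using elim
        by (intro order_trans[OF dist[unfolded h_def]] mult_right_mono abs_ge_self) auto
      also have "\<dots> \<le> \<bar>D * (2 / \<alpha>)\<bar> * ((real k - 1) powr (\<alpha> * of_int \<lceil>1 / \<alpha> - 1\<rceil>)
          * exp (- ((real k - 1) powr \<alpha>)))"
        using elim exponent by (intro mult_left_mono mult_right_mono powr_mono) auto
      finally show ?case by simp
    qed
  qed
  with finite value_rate steps lim xbar show ?thesis by blast
qed

end
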